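(* Let $n \in \mathbb{N}$, $\beta \geq 0$ and $p \in [0,\infty)$, and consider the constraint $\|\boldsymbol{x}\|_p \leq \beta$ on $\boldsymbol{x} \in \mathbb{R}^n$. Then this constraint can be written as $\eta(\boldsymbol{x}) \leq \bar\beta$ (that is, for every $\boldsymbol{x} \in \mathbb{R}^n$, $\|\boldsymbol{x}\|_p \leq \beta$ if and only if $\eta(\boldsymbol{x}) \leq \bar\beta$) for a scale function $\eta(\boldsymbol{x}) = \sum_{i=1}^n \eta_i(x_i)$ such that: (i) if $p \in (0,\infty)$, then $\eta_i(x_i) = |x_i|^p$ for $i \in [n]$ and $\bar\beta = \beta^p$; (ii) if $p = 0$, then for $i \in [n]$, $\eta_i(x_i) = 0$ for $x_i = 0$ and $\eta_i(x_i) = 1$ for $x_i \neq 0$, and $\bar\beta = \beta$.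
   Context: Notation: $[n] = \{1,\dots,n\}$. For $p \in (0,\infty)$, $\|\boldsymbol{x}\|_p = \left(\sum_{i=1}^n |x_i|^p\right)^{1/p}$ (also called the $\ell_p$-norm for $p<1$), and $\|\boldsymbol{x}\|_0$ is the number of indices $i \in [n]$ with $x_i \neq 0$. Definition (scale function). A scale function is a function $\eta:\mathbb{R}^n \to \mathbb{R}_+$ of the form $\eta(\boldsymbol{x}) = \sum_{i=1}^n \eta_i(x_i)$, where each $\eta_i:\mathbb{R} \to \mathbb{R}_+ = [0,\infty)$ is a real-valued univariate function such that (i) $\eta_i(x) = 0$ if and only if $x = 0$; (ii) $\eta_i(x_1) \leq \eta_i(x_2)$ whenever $0 \leq x_1 \leq x_2$; (iii) $\eta_i(x_1) \geq \eta_i(x_2)$ whenever $x_1 \leq x_2 \leq 0$. *)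

theory Defs
  imports "HOL-Analysis.Analysis"
begin

text \<open>The dimension is \<^term>\<open>CARD('n)\<close>. Since \<^prop>\<open>0 powr q = (0::real)\<close> for every \<open>q\<close>,
  \<open>powr\<close> on non-negative reals agrees with the usual power for positive exponents.
  The case \<open>p = 0\<close> is the counting ``norm'', not an instance of the formula for \<open>p > 0\<close>.
  Negative \<open>p\<close> is not meaningful here.\<close>

definition lp_norm :: "real \<Rightarrow> real ^ 'n \<Rightarrow> real" where
  "lp_norm p x =
     (if p = 0 then real (card {i. x $ i \<noteq> 0})
      else (\<Sum>i\<in>UNIV. \<bar>x $ i\<bar> powr p) powr (1 / p))"

definition univariate_scale_function :: "(real \<Rightarrow> real) \<Rightarrow> bool" where
  "univariate_scale_function f \<longleftrightarrow>
     (\<forall>t. 0 \<le> f t) \<and>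
     (\<forall>t. f t = 0 \<longleftrightarrow> t = 0) \<and>
     (\<forall>s t. 0 \<le> s \<and> s \<le> t \<longrightarrow> f s \<le> f t) \<and>
     (\<forall>s t. s \<le> t \<and> t \<le> 0 \<longrightarrow> f s \<ge> f t)"

text \<open>The summands are kept as an explicit argument, so that they can be referred to;
  \<open>\<eta>\<close> is a scale function if this holds for some family \<open>\<eta>c\<close>.\<close>

definition scale_function_with ::
    "('n \<Rightarrow> real \<Rightarrow> real) \<Rightarrow> (real ^ 'n \<Rightarrow> real) \<Rightarrow> bool" where
  "scale_function_with \<eta>c \<eta> \<longleftrightarrow>
     (\<forall>i. univariate_scale_function (\<eta>c i)) \<and>
     (\<forall>x. \<eta> x = (\<Sum>i\<in>UNIV. \<eta>c i (x $ i)))"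

end

theory Submission
  imports Defs
begin

text \<open>The constraint on the norm is already a constraint on a separable sum, up to the
  outer root. For \<open>p > 0\<close> the maps \<open>u \<mapsto> u powr p\<close> and \<open>u \<mapsto> u powr (1 / p)\<close> are mutually
  inverse increasing bijections of the non-negative reals, so the root can be moved to the
  right-hand side (\<open>powr_inverse_le_iff\<close>), which leaves a sum of powers of absolute values.
  For \<open>p = 0\<close> there is no root to move: the number of non-zero coordinates is the sum of their
  indicators. In both cases the summand vanishes only at \<open>0\<close> and is non-decreasing in
  the absolute value of its argument, which is what a scale function requires.\<close>

lemma univariate_scale_function_abs_powr:
  assumes "p > 0"
  shows "univariate_scale_function (\<lambda>t. \<bar>t\<bar> powr p)"
  unfolding univariate_scale_function_def using assms by (auto intro!: powr_mono2)

lemma univariate_scale_function_nonzero_indicator: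
  "univariate_scale_function (\<lambda>t. if t = 0 then 0 else 1)"
  unfolding univariate_scale_function_def by auto

lemma powr_inverse_le_iff:
  fixes s b p :: real
  assumes "s \<ge> 0" "b \<ge> 0" "p > 0"
  shows "s powr (1 / p) \<le> b \<longleftrightarrow> s \<le> b powr p"
proof -
  have "s powr (1 / p) \<le> b \<longleftrightarrow> (s powr (1 / p)) powr p \<le> b powr p"
    using assms powr_mono2[of p "s powr (1 / p)" b] powr_less_mono2[of p b "s powr (1 / p)"]
    by force
  then show ?thesis
    using assms by (simp add: powr_powr)
qed

lemma lp_norm_pos_le_iff:
  assumes "p > 0" "\<beta> \<ge> 0"
  shows "lp_norm p x \<le> \<beta> \<longleftrightarrow> (\<Sum>i\<in>UNIV. \<bar>x $ i\<bar> powr p) \<le> \<beta> powr p"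
  using assms by (simp add: lp_norm_def powr_inverse_le_iff sum_nonneg)

lemma lp_norm_0_eq_sum:
  "lp_norm 0 x = (\<Sum>i\<in>UNIV. if x $ i = 0 then 0 else 1)"
proof -
  have "(\<Sum>i\<in>UNIV. if x $ i = 0 then 0 else (1 :: real)) = (\<Sum>i | x $ i \<noteq> 0. 1)"
    by (rule sum.mono_neutral_cong_right) auto
  then show ?thesis
    by (simp add: lp_norm_def)
qed

theorem proposition2:
  fixes \<beta> p :: real
  assumes "\<beta> \<ge> 0" and "p \<ge> 0"
  shows "\<exists>(\<eta> :: real ^ 'n \<Rightarrow> real) (\<eta>c :: 'n \<Rightarrow> real \<Rightarrow> real) (\<beta>' :: real).
           scale_function_with \<eta>c \<eta> \<and>
           (\<forall>x. lp_norm p x \<le> \<beta> \<longleftrightarrow> \<eta> x \<le> \<beta>') \<and>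
           (p > 0 \<longrightarrow> (\<forall>i t. \<eta>c i t = \<bar>t\<bar> powr p) \<and> \<beta>' = \<beta> powr p) \<and>
           (p = 0 \<longrightarrow> (\<forall>i t. \<eta>c i t = (if t = 0 then 0 else 1)) \<and> \<beta>' = \<beta>)"
proof (cases "p = 0")
  case True
  let ?\<eta>c = "\<lambda>(i :: 'n) (t :: real). if t = 0 then 0 else (1 :: real)"
  let ?\<eta> = "\<lambda>x :: real ^ 'n. \<Sum>i\<in>UNIV. ?\<eta>c i (x $ i)"
  have "scale_function_with ?\<eta>c ?\<eta>"
    by (simp add: scale_function_with_def univariate_scale_function_nonzero_indicator)
  moreover have "\<forall>x. lp_norm p x \<le> \<beta> \<longleftrightarrow> ?\<eta> x \<le> \<beta>"
    using True by (simp add: lp_norm_0_eq_sum)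
  ultimately show ?thesis
    using True by (intro exI[of _ ?\<eta>] exI[of _ ?\<eta>c] exI[of _ \<beta>]) simp
next
  case False
  with assms have p: "p > 0" by simp
  let ?\<eta>c = "\<lambda>(i :: 'n) (t :: real). \<bar>t\<bar> powr p"
  let ?\<eta> = "\<lambda>x :: real ^ 'n. \<Sum>i\<in>UNIV. ?\<eta>c i (x $ i)"
  have "scale_function_with ?\<eta>c ?\<eta>"
    using p by (simp add: scale_function_with_def univariate_scale_function_abs_powr)
  moreover have "\<forall>x. lp_norm p x \<le> \<beta> \<longleftrightarrow> ?\<eta> x \<le> \<beta> powr p"
    using p assms by (simp add: lp_norm_pos_le_iff)
  ultimately show ?thesis
    using p by (intro exI[of _ ?\<eta>] exI[of _ ?\<eta>c] exI[of _ "\<beta> powr p"]) simp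
qed

end
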